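(* Let $A\in\mathbb{R}^{n\times n}$, $n=2\ell$, be nonsingular and skew-symmetric with simple eigenvalues $\pm\mathrm{i}\sigma_j$, $\sigma_1>\dots>\sigma_\ell>0$, and singular triplets $(\sigma_j,u_j,v_j)$, $j=1,\dots,\ell$. Let $m<\ell$, suppose the $m$-step SSLBD process does not break down, and let $(\theta_i,\tilde u_i,\tilde v_i)$, $i=1,\dots,m$, be the Ritz approximations of $A$ with respect to the left and right searching subspaces $\mathcal{U}_m$ and $\mathcal{V}_m$. Fix $j\in\{1,\dots,\ell\}$ and let $(\theta_{j'},\tilde u_{j'},\tilde v_{j'})$ be the Ritz approximation to $(\sigma_j,u_j,v_j)$ for which $\theta_{j'}$ is the closest to $\sigma_j$ among the Ritz values $\theta_1,\dots,\theta_m$. Denote $\mathcal{X}_j=\mathrm{span}\{u_j,v_j\}$ and $\mathcal{Z}_{j'}=\mathrm{span}\{\tilde u_{j'},\tilde v_{j'}\}$. Then $$\|\sin\angle(\mathcal{Z}_{j'},\mathcal{X}_j)\|_F\le\sqrt{1+\frac{\|\mathcal{Q}_mA(I-\mathcal{Q}_m)\|^2}{\min_{i\ne j'}|\sigma_j-\theta_i|^2}}\;\|\sin\angle(\mathcal{U}_m\oplus\mathcal{V}_m,\mathcal{X}_j)\|_F,$$ where $\mathcal{Q}_m$ is the orthogonal projector onto the subspace $\mathcal{U}_m\oplus\mathcal{V}_m$.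
   Context: Singular vectors: $u_1,\dots,u_\ell,v_1,\dots,v_\ell\in\mathbb{R}^n$ form an orthonormal basis of $\mathbb{R}^n$ with $Av_j=\sigma_ju_j$ and $Au_j=-\sigma_jv_j$. SSLBD process: set $\gamma_0=0$, $p_0=\mathbf{0}$ and choose $q_1\in\mathbb{R}^n$ with $\|q_1\|=1$. For $j=1,\dots,m$: $s_j=Aq_j-\gamma_{j-1}p_{j-1}$, $\beta_j=\|s_j\|$, stop (breakdown) if $\beta_j=0$, else $p_j=s_j/\beta_j$; $t_j=-Ap_j-\beta_jq_j$, $\gamma_j=\|t_j\|$, stop (breakdown) if $\gamma_j=0$, else $q_{j+1}=t_j/\gamma_j$. Let $P_m=[p_1,\dots,p_m]$, $Q_m=[q_1,\dots,q_m]$, $\mathcal{U}_m=\mathcal{R}(P_m)$, $\mathcal{V}_m=\mathcal{R}(Q_m)$, and let $B_m\in\mathbb{R}^{m\times m}$ be the upper bidiagonal matrix with diagonal $\beta_1,\dots,\beta_m$ and superdiagonal $\gamma_1,\dots,\gamma_{m-1}$. Without breakdown, the columns of $[P_m,Q_m]$ are orthonormal, $AQ_m=P_mB_m$, and $AP_m=-Q_mB_m^T-\gamma_mq_{m+1}e_{m,m}^T$, where $e_{m,m}$ is the $m$th column of $I_m$; the singular values of $B_m$ are simple. Ritz approximations: let $(\theta_i,c_i,d_i)$, $i=1,\dots,m$, be the singular triplets of $B_m$ ($B_md_i=\theta_ic_i$, $B_m^Tc_i=\theta_id_i$, with $\{c_i\}$ and $\{d_i\}$ orthonormal), $\theta_1>\theta_2>\dots>\theta_m$.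 Then $\tilde u_i=P_mc_i$ and $\tilde v_i=Q_md_i$ are the left and right Ritz vectors and the $\theta_i$ are the Ritz values. Norms: $\|\cdot\|$ and $\|\cdot\|_F$ are the 2- and Frobenius norms. For subspaces $\mathcal{W},\mathcal{Z}$ with orthonormal basis matrices $W,Z$, $\|\sin\angle(\mathcal{W},\mathcal{Z})\|_F=\|(I-WW^H)Z\|_F$. If $m=1$, the minimum over the empty index set is read as $+\infty$. *)

theory Defs
  imports "HOL-Analysis.Analysis" "HOL-Computational_Algebra.Polynomial"
begin

section \<open>Eigenvalues of a matrix\<close>

definition eigenvalue :: "'a::field^'n^'n \<Rightarrow> 'a \<Rightarrow> bool" where
  "eigenvalue M z \<longleftrightarrow> (\<exists>x. x \<noteq> 0 \<and> M *v x = z *s x)"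

definition char_poly :: "'a::field^'n^'n \<Rightarrow> 'a poly" where
  "char_poly M = det (mat [:0, 1:] - map_matrix (\<lambda>x. [:x:]) M)"

text \<open>Simple means of algebraic multiplicity one.\<close>

definition simple_eigenvalue :: "'a::field^'n^'n \<Rightarrow> 'a \<Rightarrow> bool" where
  "simple_eigenvalue M z \<longleftrightarrow> eigenvalue M z \<and> order z (char_poly M) = 1"


section \<open>Orthonormal families and bases, orthogonal projectors\<close>

definition orthonormal_family :: "'i set \<Rightarrow> ('i \<Rightarrow> 'a::real_inner) \<Rightarrow> bool" where
  "orthonormal_family I f \<longleftrightarrow>
     (\<forall>i\<in>I. \<forall>k\<in>I. f i \<bullet> f k = (if i = k then 1 else 0))"

definition orthonormal_basis :: "'a::real_inner set \<Rightarrow> 'a set \<Rightarrow> bool" where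
  "orthonormal_basis S B \<longleftrightarrow>
     pairwise orthogonal B \<and> (\<forall>x\<in>B. norm x = 1) \<and> span B = S"

definition orthogonal_projector :: "real^'n^'n \<Rightarrow> (real^'n) set \<Rightarrow> bool" where
  "orthogonal_projector E S \<longleftrightarrow>
     E ** E = E \<and> transpose E = E \<and> range ((*v) E) = S"


section \<open>Canonical angles between subspaces\<close>

text \<open>
  For subspaces \<open>S\<close> and \<open>T\<close> with orthonormal basis matrices \<open>W\<close> and \<open>Z\<close>, this is the Frobenius norm
  of \<open>(I - W W\<^sup>T) Z\<close>. Since the number of columns of \<open>W\<close> and \<open>Z\<close> depends on \<open>S\<close> and \<open>T\<close>,
  a basis matrix is represented by the set of its columns, and the norm is computed column by
  column: \<open>W W\<^sup>T z\<close> is the sum of \<open>(w \<bullet> z) w\<close> over the columns \<open>w\<close> of \<open>W\<close>. The lemmas below show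
  that the value does not depend on the bases, and that it is the Frobenius norm of the matrix.
\<close>

definition sin_angle_F :: "'a::euclidean_space set \<Rightarrow> 'a set \<Rightarrow> real" where
  "sin_angle_F S T = (THE r. \<exists>W Z. orthonormal_basis S W \<and> orthonormal_basis T Z \<and>
     r = sqrt (\<Sum>z\<in>Z. (norm (z - (\<Sum>w\<in>W. (w \<bullet> z) *\<^sub>R w)))\<^sup>2))"

lemma orthonormal_basis_finite:
  fixes B :: "'a::euclidean_space set"
  assumes "orthonormal_basis S B"
  shows "finite B"
  using assms pairwise_orthogonal_imp_finite by (auto simp: orthonormal_basis_def)

lemma orthonormal_basis_inner:
  assumes "orthonormal_basis S B" "x \<in> B" "y \<in> B"
  shows "x \<bullet> y = (if x = y then 1 else 0)"
  using assms
  by (auto simp: orthonormal_basis_def pairwise_def orthogonal_def norm_eq_1)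

lemma orthonormal_basis_proj_orth:
  fixes B :: "'a::euclidean_space set"
  assumes B: "orthonormal_basis S B" and y: "y \<in> S"
  shows "(x - (\<Sum>w\<in>B. (w \<bullet> x) *\<^sub>R w)) \<bullet> y = 0"
proof -
  note fin = orthonormal_basis_finite[OF B]
  have "orthogonal (x - (\<Sum>w\<in>B. (w \<bullet> x) *\<^sub>R w)) b" if "b \<in> B" for b
  proof -
    have "(\<Sum>w\<in>B. (w \<bullet> x) *\<^sub>R w) \<bullet> b = (\<Sum>w\<in>B. (w \<bullet> x) * (w \<bullet> b))"
      by (simp add: inner_sum_left)
    also have "\<dots> = (\<Sum>w\<in>B. if w = b then w \<bullet> x else 0)"
      using orthonormal_basis_inner[OF B _ that] by (intro sum.cong) auto
    also have "\<dots> = b \<bullet> x"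
      using fin that by simp
    finally show ?thesis
      by (simp add: orthogonal_def inner_diff_left inner_commute[of x b])
  qed
  moreover have "y \<in> span B"
    using B y by (simp add: orthonormal_basis_def)
  ultimately show ?thesis
    using orthogonal_to_span[of y B] unfolding orthogonal_def by blast
qed

lemma orthonormal_basis_proj_in:
  assumes B: "orthonormal_basis S B"
  shows "(\<Sum>w\<in>B. (w \<bullet> x) *\<^sub>R w) \<in> S"
  using B unfolding orthonormal_basis_def
  by (metis (no_types, lifting) span_base span_scale span_sum)

lemma orthonormal_basis_proj_unique:
  fixes B :: "'a::euclidean_space set"
  assumes B: "orthonormal_basis S B" and C: "orthonormal_basis S C"
  shows "(\<Sum>w\<in>B. (w \<bullet> x) *\<^sub>R w) = (\<Sum>w\<in>C. (w \<bullet> x) *\<^sub>R w)" (is "?b = ?c")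
proof -
  have "subspace S"
    using B by (auto simp: orthonormal_basis_def)
  then have d: "?b - ?c \<in> S"
    using orthonormal_basis_proj_in[OF B] orthonormal_basis_proj_in[OF C] subspace_diff by blast
  have "(?b - ?c) \<bullet> (?b - ?c) = (x - ?c) \<bullet> (?b - ?c) - (x - ?b) \<bullet> (?b - ?c)"
    by (simp add: inner_diff_left)
  also have "\<dots> = 0"
    using orthonormal_basis_proj_orth[OF B d] orthonormal_basis_proj_orth[OF C d] by simp
  finally show ?thesis by simp
qed

lemma orthonormal_basis_sum_squares:
  fixes B :: "'a::euclidean_space set"
  assumes B: "orthonormal_basis S B"
  shows "(\<Sum>w\<in>B. (w \<bullet> x)\<^sup>2) = x \<bullet> (\<Sum>w\<in>B. (w \<bullet> x) *\<^sub>R w)"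
  by (simp add: inner_sum_right power2_eq_square inner_commute)

lemma sin_angle_F_eq:
  fixes W Z :: "'a::euclidean_space set"
  assumes W: "orthonormal_basis S W" and Z: "orthonormal_basis T Z"
  shows "sin_angle_F S T = sqrt (\<Sum>z\<in>Z. (norm (z - (\<Sum>w\<in>W. (w \<bullet> z) *\<^sub>R w)))\<^sup>2)"
proof -
  define L where "L = (\<lambda>z. z - (\<Sum>w\<in>W. (w \<bullet> z) *\<^sub>R w))"
  have sym: "L x \<bullet> y = x \<bullet> L y" for x y
    by (simp add: L_def inner_diff_left inner_diff_right inner_sum_left inner_sum_right
        inner_commute mult.commute)
  have trace: "(\<Sum>z\<in>C. (norm (L z))\<^sup>2) = (\<Sum>b\<in>Basis. L b \<bullet> (\<Sum>z\<in>C. (z \<bullet> L b) *\<^sub>R z))"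
    if C: "orthonormal_basis T C" for C
  proof -
    have "(\<Sum>z\<in>C. (norm (L z))\<^sup>2) = (\<Sum>z\<in>C. \<Sum>b\<in>Basis. (L z \<bullet> b)\<^sup>2)"
      unfolding power2_norm_eq_inner
      by (intro sum.cong refl, subst euclidean_inner) (simp add: power2_eq_square)
    also have "\<dots> = (\<Sum>b\<in>Basis. \<Sum>z\<in>C. (z \<bullet> L b)\<^sup>2)"
      unfolding sym by (rule sum.swap)
    finally show ?thesis
      using orthonormal_basis_sum_squares[OF C] by simp
  qed
  have uniq: "(\<Sum>z\<in>C. (norm (z - (\<Sum>w\<in>V. (w \<bullet> z) *\<^sub>R w)))\<^sup>2) =
      (\<Sum>z\<in>Z. (norm (z - (\<Sum>w\<in>W. (w \<bullet> z) *\<^sub>R w)))\<^sup>2)"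
    if V: "orthonormal_basis S V" and C: "orthonormal_basis T C" for V C
  proof -
    have "(\<Sum>z\<in>C. (norm (z - (\<Sum>w\<in>V. (w \<bullet> z) *\<^sub>R w)))\<^sup>2) = (\<Sum>z\<in>C. (norm (L z))\<^sup>2)"
      using orthonormal_basis_proj_unique[OF V W] by (simp add: L_def)
    also have "\<dots> = (\<Sum>z\<in>Z. (norm (L z))\<^sup>2)"
      unfolding trace[OF C] trace[OF Z] orthonormal_basis_proj_unique[OF C Z] ..
    finally show ?thesis
      by (simp add: L_def)
  qed
  show ?thesis
    unfolding sin_angle_F_def
  proof (rule the_equality)
    fix r
    assume "\<exists>V C. orthonormal_basis S V \<and> orthonormal_basis T C \<and>
      r = sqrt (\<Sum>z\<in>C. (norm (z - (\<Sum>w\<in>V. (w \<bullet> z) *\<^sub>R w)))\<^sup>2)"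
    then show "r = sqrt (\<Sum>z\<in>Z. (norm (z - (\<Sum>w\<in>W. (w \<bullet> z) *\<^sub>R w)))\<^sup>2)"
      using uniq by auto
  qed (use W Z in blast)
qed

lemma orthonormal_basis_columns:
  fixes W :: "real^'w^'n"
  assumes "transpose W ** W = mat 1"
  shows "orthonormal_basis (range ((*v) W)) (columns W)" "inj (\<lambda>k. column k W)"
proof -
  have ip: "column i W \<bullet> column k W = (if i = k then 1 else 0)" for i k
    using arg_cong[OF assms, of "\<lambda>M. M $ i $ k"]
    by (simp add: matrix_matrix_mult_def transpose_def mat_def column_def inner_vec_def)
  then show "inj (\<lambda>k. column k W)"
    by (metis injI zero_neq_one)
  have "W *v axis k 1 = column k W" for k
    by (simp add: matrix_vector_mult_basis)
  then have "columns W \<subseteq> range ((*v) W)"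
    unfolding columns_def by (auto intro: range_eqI[OF sym])
  then have "span (columns W) = range ((*v) W)"
    using matrix_vector_mult_in_columnspace[of W]
    by (intro antisym span_minimal linear_subspace_image) auto
  then show "orthonormal_basis (range ((*v) W)) (columns W)"
    using ip by (auto simp: orthonormal_basis_def columns_def pairwise_def orthogonal_def norm_eq_1)
qed

text \<open>The norm of the type \<^typ>\<open>real^'z^'n\<close> is the Frobenius norm.\<close>

lemma sin_angle_F_matrix:
  fixes W :: "real^'w^'n" and Z :: "real^'z^'n"
  assumes "transpose W ** W = mat 1" "transpose Z ** Z = mat 1"
  shows "sin_angle_F (range ((*v) W)) (range ((*v) Z)) =
    norm ((mat 1 - W ** transpose W) ** Z)"
proof -
  note W = orthonormal_basis_columns[OF assms(1)] and Z = orthonormal_basis_columns[OF assms(2)]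
  have cols: "columns W = range (\<lambda>k. column k W)" "columns Z = range (\<lambda>k. column k Z)"
    by (auto simp: columns_def)
  have proj: "(\<Sum>w\<in>columns W. (w \<bullet> z) *\<^sub>R w) = (W ** transpose W) *v z" for z
  proof -
    have "(\<Sum>w\<in>columns W. (w \<bullet> z) *\<^sub>R w) = (\<Sum>k\<in>UNIV. (column k W \<bullet> z) *\<^sub>R column k W)"
      unfolding cols by (subst sum.reindex[OF W(2)]) simp
    also have "\<dots> = W *v (transpose W *v z)"
    proof -
      have "(transpose W *v z) $ k = column k W \<bullet> z" for k
        unfolding matrix_vector_mul_component by (simp add: transpose_def column_def)
      then show ?thesis
        unfolding matrix_mult_sum[of W] scalar_mult_eq_scaleR by simp
    qed
    finally show ?thesis
      by (simp only: matrix_vector_mul_assoc)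
  qed
  have frob: "(norm M)\<^sup>2 = (\<Sum>k\<in>UNIV. (norm (column k M))\<^sup>2)" for M :: "real^'z^'n"
    unfolding power2_norm_eq_inner inner_vec_def column_def
    by (simp, rule sum.swap)
  have col: "column k ((mat 1 - W ** transpose W) ** Z) =
      column k Z - (W ** transpose W) *v column k Z" for k
    by (simp flip: matrix_vector_mult_basis matrix_vector_mul_assoc
        add: matrix_vector_mult_diff_rdistrib)
  have "(\<Sum>z\<in>columns Z. (norm (z - (\<Sum>w\<in>columns W. (w \<bullet> z) *\<^sub>R w)))\<^sup>2) =
      (\<Sum>k\<in>UNIV. (norm (column k ((mat 1 - W ** transpose W) ** Z)))\<^sup>2)"
    unfolding proj unfolding cols
    by (subst sum.reindex[OF Z(2)]) (simp add: col)
  then show ?thesis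
    unfolding sin_angle_F_eq[OF W(1) Z(1)] by (simp flip: frob)
qed


section \<open>Skew-symmetric Lanczos bidiagonalization\<close>

text \<open>
  \<open>sslbd A m p q \<beta> \<gamma>\<close>: the vectors \<open>p\<^sub>1, \<dots>, p\<^sub>m, q\<^sub>1, \<dots>, q\<^sub>m\<^sub>+\<^sub>1\<close> and the numbers
  \<open>\<beta>\<^sub>1, \<dots>, \<beta>\<^sub>m, \<gamma>\<^sub>1, \<dots>, \<gamma>\<^sub>m\<close> are computed by \<open>m\<close> steps of the process, none of which breaks down.
  The starting vector is \<open>q\<^sub>1\<close>; the sequences are unconstrained beyond these indices.
\<close>

definition sslbd ::
  "real^'n^'n \<Rightarrow> nat \<Rightarrow> (nat \<Rightarrow> real^'n) \<Rightarrow> (nat \<Rightarrow> real^'n) \<Rightarrow> (nat \<Rightarrow> real) \<Rightarrow> (nat \<Rightarrow> real) \<Rightarrow> bool"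
where
  "sslbd A m p q \<beta> \<gamma> \<longleftrightarrow>
     \<gamma> 0 = 0 \<and> p 0 = 0 \<and> norm (q 1) = 1 \<and>
     (\<forall>j\<in>{1..m}.
        let s = A *v q j - \<gamma> (j - 1) *\<^sub>R p (j - 1);
            t = - (A *v p j) - \<beta> j *\<^sub>R q j
        in \<beta> j = norm s \<and> \<beta> j \<noteq> 0 \<and> p j = s /\<^sub>R \<beta> j \<and>
           \<gamma> j = norm t \<and> \<gamma> j \<noteq> 0 \<and> q (j + 1) = t /\<^sub>R \<gamma> j)"

text \<open>
  The \<open>m\<close> columns of \<open>P\<^sub>m\<close>, \<open>Q\<^sub>m\<close> and \<open>B\<^sub>m\<close> are indexed by a linearly ordered finite type with \<open>m\<close>
  elements (such as a numeral type); \<open>pos\<close> numbers its elements as 1, ..., \<open>m\<close> in increasing order.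
\<close>

definition pos :: "'m::{finite,linorder} \<Rightarrow> nat" where
  "pos k = card {..k}"

definition columns_matrix :: "(nat \<Rightarrow> real^'n) \<Rightarrow> real^'m::{finite,linorder}^'n" where
  "columns_matrix x = (\<chi> r k. x (pos k) $ r)"

definition bidiagonal ::
  "(nat \<Rightarrow> real) \<Rightarrow> (nat \<Rightarrow> real) \<Rightarrow> real^'m::{finite,linorder}^'m::{finite,linorder}"
where
  "bidiagonal \<beta> \<gamma> = (\<chi> i k. if k = i then \<beta> (pos i)
     else if pos k = pos i + 1 then \<gamma> (pos i) else 0)"

lemma bij_betw_pos: "bij_betw pos (UNIV :: 'm::{finite,linorder} set) {1..CARD('m)}"
proof -
  have "pos i < pos k" if "i < k" for i k :: 'm
    unfolding pos_def using that by (intro psubset_card_mono) auto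
  then have inj: "inj (pos :: 'm \<Rightarrow> nat)"
    by (metis injI less_irrefl linorder_neqE)
  have "pos k \<in> {1..CARD('m)}" for k :: 'm
    unfolding pos_def by (auto simp: Suc_le_eq card_gt_0_iff intro!: card_mono)
  then have "range (pos :: 'm \<Rightarrow> nat) = {1..CARD('m)}"
    using inj by (intro card_subset_eq) (auto simp: card_image)
  then show ?thesis
    using inj by (simp add: bij_betw_def)
qed

text \<open>The singular triplets \<open>(\<theta>\<^sub>i, c\<^sub>i, d\<^sub>i)\<close> of a square matrix, in decreasing order of \<open>\<theta>\<^sub>i\<close>.\<close>

definition singular_triplets ::
  "real^'m::{finite,linorder}^'m::{finite,linorder} \<Rightarrow> ('m \<Rightarrow> real) \<Rightarrow>
    ('m \<Rightarrow> real^'m::{finite,linorder}) \<Rightarrow> ('m \<Rightarrow> real^'m::{finite,linorder}) \<Rightarrow> bool"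
where
  "singular_triplets B \<theta> c d \<longleftrightarrow>
     orthonormal_family UNIV c \<and> orthonormal_family UNIV d \<and>
     (\<forall>i. 0 \<le> \<theta> i \<and> B *v d i = \<theta> i *\<^sub>R c i \<and> transpose B *v c i = \<theta> i *\<^sub>R d i) \<and>
     (\<forall>i k. i < k \<longrightarrow> \<theta> k < \<theta> i)"

end

theory Submission
  imports Defs
begin

text \<open>
  The Ritz vectors form an orthonormal basis of \<open>U\<^sub>m \<oplus> V\<^sub>m\<close> in which the compression of \<open>A\<close> is block
  diagonal with blocks of eigenvalues \<open>\<plusminus> \<i> \<theta>\<^sub>i\<close>. Compressing \<open>A v\<^sub>j = \<sigma>\<^sub>j u\<^sub>j\<close>, \<open>A u\<^sub>j = - \<sigma>\<^sub>j v\<^sub>j\<close> and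
  taking the components along the Ritz vectors of index \<open>i\<close> bounds \<open>(\<sigma>\<^sub>j - \<theta>\<^sub>i)\<^sup>2\<close> times the squared size of these
  components by the corresponding part of \<open>Q\<^sub>m A (I - Q\<^sub>m)\<close> applied to \<open>(I - Q\<^sub>m) u\<^sub>j\<close>, \<open>(I - Q\<^sub>m) v\<^sub>j\<close>. Summing
  over \<open>i \<noteq> j'\<close> bounds the part of \<open>X\<^sub>j\<close> that lies in \<open>U\<^sub>m \<oplus> V\<^sub>m\<close> but not in \<open>Z\<^sub>j\<^sub>'\<close>, and Pythagoras
  concludes.
\<close>

section \<open>Orthonormal families\<close>

lemma orthonormal_family_inj:
  assumes "orthonormal_family I f"
  shows "inj_on f I"
  using assms unfolding orthonormal_family_def by (metis inj_onI zero_neq_one)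

lemma orthonormal_family_basis:
  assumes "orthonormal_family I f"
  shows "orthonormal_basis (span (f ` I)) (f ` I)"
  using assms
  by (auto simp: orthonormal_basis_def orthonormal_family_def pairwise_def orthogonal_def norm_eq_1)

text \<open>Orthonormal vectors are independent, and here they are as many as the dimension. Hence
  the Ritz vectors will fill all of \<open>U\<close> and \<open>V\<close>.\<close>

lemma orthonormal_family_span_UNIV:
  fixes f :: "'m::finite \<Rightarrow> real^'m"
  assumes "orthonormal_family UNIV f"
  shows "span (range f) = UNIV"
proof -
  have "pairwise orthogonal (range f)" "\<forall>x\<in>range f. norm x = 1"
    using orthonormal_family_basis[OF assms] by (simp_all add: orthonormal_basis_def)
  moreover from this have "0 \<notin> range f" by (metis norm_zero zero_neq_one)
  ultimately have "independent (range f)"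
    by (simp add: pairwise_orthogonal_independent)
  moreover have "card (range f) = DIM(real^'m)"
    using orthonormal_family_inj[OF assms] by (simp add: card_image)
  ultimately have "UNIV \<subseteq> span (range f)"
    by (intro card_ge_dim_independent) auto
  then show ?thesis by blast
qed

text \<open>Pythagoras: the residual is orthogonal to the projection.\<close>

lemma orthonormal_basis_residual:
  fixes W :: "'a::euclidean_space set"
  assumes W: "orthonormal_basis S W"
  shows "(norm (z - (\<Sum>w\<in>W. (w \<bullet> z) *\<^sub>R w)))\<^sup>2 = (norm z)\<^sup>2 - (\<Sum>w\<in>W. (w \<bullet> z)\<^sup>2)"
proof -
  let ?s = "\<Sum>w\<in>W. (w \<bullet> z) *\<^sub>R w"
  have "(z - ?s) \<bullet> ?s = 0"
    using orthonormal_basis_proj_orth[OF W orthonormal_basis_proj_in[OF W]] .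
  then have "(norm (z - ?s))\<^sup>2 = z \<bullet> z - z \<bullet> ?s"
    unfolding power2_norm_eq_inner by (simp add: inner_diff_left inner_diff_right inner_commute)
  then show ?thesis
    using orthonormal_basis_sum_squares[OF W, of z] by (simp add: power2_norm_eq_inner)
qed

text \<open>The 2 collects the squared norms of the unit vectors \<open>x\<close> and
  \<open>y\<close>. In this form both sines of the theorem become sums over Ritz vectors that can be
  compared term by term.\<close>

lemma sin_angle_F_pair:
  fixes f :: "'i \<Rightarrow> 'a::euclidean_space" and x y :: 'a
  assumes f: "orthonormal_family I f" and S: "span (f ` I) = S"
    and xy: "norm x = 1" "norm y = 1" "x \<bullet> y = 0"
  shows "sin_angle_F S (span {x, y}) =
    sqrt (2 - (\<Sum>i\<in>I. (f i \<bullet> x)\<^sup>2 + (f i \<bullet> y)\<^sup>2))"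
proof -
  have W: "orthonormal_basis S (f ` I)"
    using orthonormal_family_basis[OF f] S by simp
  have Z: "orthonormal_basis (span {x, y}) {x, y}"
    using xy by (auto simp: orthonormal_basis_def pairwise_def orthogonal_def inner_commute)
  \<comment> \<open>The basis \<open>{x, y}\<close> is a set, so a sum over it has two terms only if
    the vectors differ.\<close>
  have "x \<noteq> y"
    using xy by auto
  then have "sin_angle_F S (span {x, y}) =
      sqrt (2 - ((\<Sum>w\<in>f ` I. (w \<bullet> x)\<^sup>2) + (\<Sum>w\<in>f ` I. (w \<bullet> y)\<^sup>2)))"
    unfolding sin_angle_F_eq[OF W Z] orthonormal_basis_residual[OF W]
    using xy by (simp add: algebra_simps)
  then show ?thesis
    by (simp add: sum.reindex[OF orthonormal_family_inj[OF f]] sum.distrib)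
qed


section \<open>Orthogonal projectors\<close>

lemma orthogonal_projector_idem:
  "orthogonal_projector E S \<Longrightarrow> E *v (E *v x) = E *v x"
  by (simp add: orthogonal_projector_def matrix_vector_mul_assoc)

lemma orthogonal_projector_sym:
  "orthogonal_projector E S \<Longrightarrow> (E *v x) \<bullet> y = x \<bullet> (E *v y)"
  by (metis dot_lmul_matrix orthogonal_projector_def transpose_matrix_vector)

lemma orthogonal_projector_fixes:
  "orthogonal_projector E S \<Longrightarrow> x \<in> S \<Longrightarrow> E *v x = x"
  using orthogonal_projector_idem[of E S] by (auto simp: orthogonal_projector_def)

lemma orthogonal_projector_inner:
  assumes "orthogonal_projector E S" "x \<in> S"
  shows "x \<bullet> (E *v y) = x \<bullet> y"
  using orthogonal_projector_sym[OF assms(1), of x y] orthogonal_projector_fixes[OF assms] by simp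

lemma orthogonal_projector_eq_0:
  assumes E: "orthogonal_projector E S" and "\<And>x. x \<in> S \<Longrightarrow> x \<bullet> y = 0"
  shows "E *v y = 0"
proof -
  have "E *v y \<in> S"
    using E by (auto simp: orthogonal_projector_def)
  then have "(E *v y) \<bullet> (E *v y) = 0"
    using assms orthogonal_projector_inner[OF E] by simp
  then show ?thesis by simp
qed

text \<open>The residual of the expansion is orthogonal to \<open>S\<close>, so \<open>E\<close>
  kills it, while \<open>E\<close> fixes the expansion itself. This links the projector to the
  residuals inside \<open>sin_angle_F\<close>.\<close>

lemma orthogonal_projector_eq_sum:
  assumes E: "orthogonal_projector E S" and W: "orthonormal_basis S W"
  shows "E *v z = (\<Sum>w\<in>W. (w \<bullet> z) *\<^sub>R w)"
proof -
  let ?s = "\<Sum>w\<in>W. (w \<bullet> z) *\<^sub>R w"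
  have "E *v (z - ?s) = 0"
    using orthonormal_basis_proj_orth[OF W]
    by (intro orthogonal_projector_eq_0[OF E]) (subst inner_commute)
  then show ?thesis
    using orthogonal_projector_fixes[OF E orthonormal_basis_proj_in[OF W]]
    by (simp add: matrix_vector_mult_diff_distrib)
qed

lemma orthonormal_family_bessel:
  fixes f :: "'i \<Rightarrow> 'a::euclidean_space"
  assumes f: "orthonormal_family I f"
  shows "(\<Sum>i\<in>I. (f i \<bullet> x)\<^sup>2) \<le> (norm x)\<^sup>2"
proof -
  have "0 \<le> (norm x)\<^sup>2 - (\<Sum>w\<in>f ` I. (w \<bullet> x)\<^sup>2)"
    unfolding orthonormal_basis_residual[OF orthonormal_family_basis[OF f], symmetric] by simp
  then show ?thesis
    by (simp add: sum.reindex[OF orthonormal_family_inj[OF f]])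
qed

lemma skew_inner:
  fixes A :: "real^'n^'n"
  assumes "transpose A = - A"
  shows "(A *v x) \<bullet> y = - (x \<bullet> (A *v y))"
proof -
  have "(A *v x) \<bullet> y = x \<bullet> (transpose A *v y)"
    by (metis dot_lmul_matrix transpose_matrix_vector transpose_transpose)
  \<comment> \<open>Distributivity over the difference \<open>0 - A\<close> yields
    \<open>(- A) *v y = - (A *v y)\<close>.\<close>
  then show ?thesis
    using matrix_vector_mult_diff_rdistrib[of 0 A y] by (simp add: assms)
qed

text \<open>The residual \<open>z - E *v z\<close> is fixed by \<open>mat 1 - E\<close>, so the
  compressed matrix can act on it directly. Bounding by the residual instead of \<open>z\<close> is
  what later produces the sine of the angle with \<open>U + V\<close>.\<close>

lemma onorm_compression_bound:
  fixes A E :: "real^'n^'n"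
  assumes E: "orthogonal_projector E S"
  shows "norm (E *v (A *v (z - E *v z))) \<le>
    onorm ((*v) (E ** A ** (mat 1 - E))) * norm (z - E *v z)"
proof -
  have "E *v (A *v (z - E *v z)) = (E ** A ** (mat 1 - E)) *v (z - E *v z)"
    by (simp add: matrix_vector_mult_diff_rdistrib matrix_vector_mult_diff_distrib
        orthogonal_projector_idem[OF E] flip: matrix_vector_mul_assoc)
  then show ?thesis
    by (simp add: onorm matrix_vector_mul_bounded_linear)
qed


section \<open>Components of a singular pair along the Ritz vectors\<close>

text \<open>The symmetric matrix with rows (t, s) and (s, t) has eigenvalues t + s and t - s, so for
  nonnegative s, t it shrinks no vector by more than |s - t|.\<close>

lemma gap_quadratic_bound:
  fixes a b s t :: real
  assumes "0 \<le> s" "0 \<le> t"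
  shows "(s - t)\<^sup>2 * (a\<^sup>2 + b\<^sup>2) \<le> (t * a + s * b)\<^sup>2 + (t * b + s * a)\<^sup>2"
proof -
  have "(t * a + s * b)\<^sup>2 + (t * b + s * a)\<^sup>2 - (s - t)\<^sup>2 * (a\<^sup>2 + b\<^sup>2) = 2 * (s * t) * (a + b)\<^sup>2"
    by (simp add: power2_eq_square algebra_simps)
  moreover have "0 \<le> 2 * (s * t) * (a + b)\<^sup>2"
    using assms by simp
  ultimately show ?thesis by linarith
qed

text \<open>The four residual components split into two pairs. Up to signs, each pair is the image
  of two coefficients under the matrix of \<open>gap_quadratic_bound\<close>.\<close>

lemma singular_pair_component_bound:
  fixes A E :: "real^'n^'n"
  assumes skew: "transpose A = - A" and E: "orthogonal_projector E S"
    and S: "ut \<in> S" "vt \<in> S" and st: "0 \<le> s" "0 \<le> t"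
    and Avt: "A *v vt = t *\<^sub>R ut" and EAut: "E *v (A *v ut) = - t *\<^sub>R vt"
    and Av: "A *v v = s *\<^sub>R u" and Au: "A *v u = - s *\<^sub>R v"
  shows "(s - t)\<^sup>2 * ((ut \<bullet> u)\<^sup>2 + (vt \<bullet> u)\<^sup>2 + (ut \<bullet> v)\<^sup>2 + (vt \<bullet> v)\<^sup>2) \<le>
    (ut \<bullet> (A *v (u - E *v u)))\<^sup>2 + (vt \<bullet> (A *v (u - E *v u)))\<^sup>2 +
    (ut \<bullet> (A *v (v - E *v v)))\<^sup>2 + (vt \<bullet> (A *v (v - E *v v)))\<^sup>2"
proof -
  \<comment> \<open>Skew-symmetry moves \<open>A\<close> onto the Ritz vector.
    \<open>A *v ut\<close> may leave \<open>S\<close>, so \<open>E\<close> must be moved onto it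
    too; \<open>A *v vt\<close> stays in \<open>S\<close>.\<close>
  have ut: "ut \<bullet> (A *v (E *v z)) = t * (vt \<bullet> z)" for z
    using skew_inner[OF skew, of ut "E *v z"] orthogonal_projector_sym[OF E, of "A *v ut" z] EAut
    by simp
  have vt: "vt \<bullet> (A *v (E *v z)) = - t * (ut \<bullet> z)" for z
    using skew_inner[OF skew, of vt "E *v z"] orthogonal_projector_inner[OF E S(1), of z] Avt
    by simp
  \<comment> \<open>The signs are arranged so that the first and fourth lines use the coefficients
    \<open>vt \<bullet> u\<close>, \<open>ut \<bullet> v\<close>, and the middle two use
    \<open>ut \<bullet> u\<close>, \<open>- (vt \<bullet> v)\<close>.\<close>
  have res: "ut \<bullet> (A *v (u - E *v u)) = - (t * (vt \<bullet> u) + s * (ut \<bullet> v))"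
    "vt \<bullet> (A *v (u - E *v u)) = t * (ut \<bullet> u) + s * - (vt \<bullet> v)"
    "ut \<bullet> (A *v (v - E *v v)) = t * - (vt \<bullet> v) + s * (ut \<bullet> u)"
    "vt \<bullet> (A *v (v - E *v v)) = t * (ut \<bullet> v) + s * (vt \<bullet> u)"
    by (simp_all add: matrix_vector_mult_diff_distrib inner_diff_right ut vt Av Au)
  show ?thesis
    unfolding res power2_minus
    using gap_quadratic_bound[OF st, of "vt \<bullet> u" "ut \<bullet> v"]
      gap_quadratic_bound[OF st, of "ut \<bullet> u" "- (vt \<bullet> v)"]
    by (simp add: algebra_simps)
qed


section \<open>The Lanczos vectors\<close>

lemma sslbd_recurrence:
  assumes "sslbd A m p q \<beta> \<gamma>" "k \<in> {1..m}"
  shows "A *v q k = \<beta> k *\<^sub>R p k + \<gamma> (k - 1) *\<^sub>R p (k - 1)"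
    and "A *v p k = - \<beta> k *\<^sub>R q k - \<gamma> k *\<^sub>R q (k + 1)"
    and "\<beta> k \<noteq> 0" "\<gamma> k \<noteq> 0" "norm (p k) = 1" "norm (q (k + 1)) = 1"
proof -
  have *: "\<beta> k = norm (A *v q k - \<gamma> (k - 1) *\<^sub>R p (k - 1))" "\<beta> k \<noteq> 0"
      "p k = (A *v q k - \<gamma> (k - 1) *\<^sub>R p (k - 1)) /\<^sub>R \<beta> k"
      "\<gamma> k = norm (- (A *v p k) - \<beta> k *\<^sub>R q k)" "\<gamma> k \<noteq> 0"
      "q (k + 1) = (- (A *v p k) - \<beta> k *\<^sub>R q k) /\<^sub>R \<gamma> k"
    using assms unfolding sslbd_def Let_def by blast+
  show "\<beta> k \<noteq> 0" "\<gamma> k \<noteq> 0" by fact+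
  have "\<beta> k *\<^sub>R p k = A *v q k - \<gamma> (k - 1) *\<^sub>R p (k - 1)"
    by (subst *(3)) (simp add: *(2))
  then show "A *v q k = \<beta> k *\<^sub>R p k + \<gamma> (k - 1) *\<^sub>R p (k - 1)" by simp
  have "\<gamma> k *\<^sub>R q (k + 1) = - (A *v p k) - \<beta> k *\<^sub>R q k"
    by (subst *(6)) (simp add: *(5))
  then show "A *v p k = - \<beta> k *\<^sub>R q k - \<gamma> k *\<^sub>R q (k + 1)" by simp
  show "norm (p k) = 1"
    unfolding *(3) norm_scaleR *(1)[symmetric] using *(1,2) by simp
  show "norm (q (k + 1)) = 1"
    unfolding *(6) norm_scaleR *(4)[symmetric] using *(4,5) by simp
qed

text \<open>Skew-symmetry moves \<open>A\<close> from the newest vector to an older one, whose image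
  involves only two neighbours by the recurrence. The q-range is one longer than the p-range because
  step n + 1 starts from \<open>q (n + 1)\<close>.\<close>

lemma sslbd_orthogonal:
  assumes skew: "transpose A = - A" and L: "sslbd A m p q \<beta> \<gamma>"
  shows "n \<le> m \<Longrightarrow>
    (\<forall>i\<in>{1..n}. \<forall>k\<in>{1..n}. p i \<bullet> p k = (if i = k then 1 else 0)) \<and>
    (\<forall>i\<in>{1..n + 1}. \<forall>k\<in>{1..n + 1}. q i \<bullet> q k = (if i = k then 1 else 0)) \<and>
    (\<forall>i\<in>{1..n}. \<forall>k\<in>{1..n + 1}. p i \<bullet> q k = 0)"
proof (induction n)
  case 0
  then show ?case using L by (simp add: sslbd_def norm_eq_1)
next
  case (Suc n)
  have p0: "p 0 = 0" using L by (simp add: sslbd_def)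
  have pp: "p i \<bullet> p k = (if i = k then 1 else 0)" if "i \<in> {1..n}" "k \<in> {1..n}" for i k
    using Suc that by auto
  have qq: "q i \<bullet> q k = (if i = k then 1 else 0)" if "i \<in> {1..n + 1}" "k \<in> {1..n + 1}" for i k
    using Suc that by auto
  have pq: "p i \<bullet> q k = 0" if "i \<le> n" "k \<in> {1..n + 1}" for i k
    using Suc that p0 by (cases "i = 0") auto
  \<comment> \<open>This settles the diagonal cases below, where the recurrence would bring in the
    vector whose orthogonality is being proved.\<close>
  have self: "(A *v x) \<bullet> x = 0" for x
    using skew_inner[OF skew, of x x] by (simp add: inner_commute)
  note r = sslbd_recurrence[OF L]
  have n1: "n + 1 \<in> {1..m}" using Suc by simp
  have sub: "k \<in> {1..m}" if "k \<in> {1..n + 1}" for k using Suc that by simp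
  have p_new: "\<beta> (n + 1) *\<^sub>R p (n + 1) = A *v q (n + 1) - \<gamma> n *\<^sub>R p n"
    using r(1)[OF n1] by simp
  have q_new: "\<gamma> (n + 1) *\<^sub>R q (n + 2) = - (A *v p (n + 1)) - \<beta> (n + 1) *\<^sub>R q (n + 1)"
    using r(2)[OF n1] by simp
  have new_pq: "p (n + 1) \<bullet> q k = 0" if k: "k \<in> {1..n + 1}" for k
  proof -
    have "(A *v q (n + 1)) \<bullet> q k = 0"
    proof (cases "k = n + 1")
      case False
      then have "k \<le> n" using k by simp
      then have "q (n + 1) \<bullet> (A *v q k) = 0"
        using r(1)[OF sub[OF k]] pq[of k "n + 1"] pq[of "k - 1" "n + 1"]
        by (simp add: inner_add_right inner_commute)
      then show ?thesis using skew_inner[OF skew, of "q (n + 1)" "q k"] by simp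
    qed (use self in simp)
    then have "(\<beta> (n + 1) *\<^sub>R p (n + 1)) \<bullet> q k = 0"
      unfolding p_new using pq[of n k] k by (simp add: inner_diff_left)
    then show ?thesis using r(3)[OF n1] by simp
  qed
  \<comment> \<open>Only for k = n does \<open>A *v p k\<close> reach \<open>q (n + 1)\<close>; that
    contribution cancels the subtracted multiple of \<open>p n\<close>.\<close>
  have new_pp: "p (n + 1) \<bullet> p k = 0" if k: "k \<in> {1..n}" for k
  proof -
    have "q (n + 1) \<bullet> (A *v p k) = (if k = n then - \<gamma> n else 0)"
      using r(2)[OF sub[of k]] k qq[of "n + 1" k] qq[of "n + 1" "k + 1"]
      by (simp add: inner_diff_right)
    then have "(\<beta> (n + 1) *\<^sub>R p (n + 1)) \<bullet> p k = 0"
      unfolding p_new using pp[of n k] k skew_inner[OF skew, of "q (n + 1)" "p k"]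
      by (simp add: inner_diff_left)
    then show ?thesis using r(3)[OF n1] by simp
  qed
  have pp': "p i \<bullet> p k = (if i = k then 1 else 0)" if "i \<in> {1..n + 1}" "k \<in> {1..n + 1}" for i k
    using that pp[of i k] new_pp[of i] new_pp[of k] r(5)[OF n1]
    by (cases "i = n + 1"; cases "k = n + 1") (auto simp: inner_commute norm_eq_1)
  have pq': "p i \<bullet> q k = 0" if "i \<in> {1..n + 1}" "k \<in> {1..n + 1}" for i k
    using that pq[of i k] new_pq[of k] by (cases "i = n + 1") auto
  have new_qp: "q (n + 2) \<bullet> p k = 0" if k: "k \<in> {1..n + 1}" for k
  proof -
    have "(A *v p (n + 1)) \<bullet> p k = 0"
    proof (cases "k = n + 1")
      case False
      then have "p (n + 1) \<bullet> (A *v p k) = 0"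
        using r(2)[OF sub[OF k]] k pq'[of "n + 1" k] pq'[of "n + 1" "k + 1"]
        by (simp add: inner_diff_right)
      then show ?thesis using skew_inner[OF skew, of "p (n + 1)" "p k"] by simp
    qed (use self in simp)
    then have "(\<gamma> (n + 1) *\<^sub>R q (n + 2)) \<bullet> p k = 0"
      unfolding q_new using pq'[of k "n + 1"] k
      by (simp add: inner_diff_left inner_commute[of "q (Suc n)"])
    then show ?thesis using r(4)[OF n1] by simp
  qed
  \<comment> \<open>Here the cancellation occurs at k = n + 1, through \<beta>. For k = 1 the index
    k - 1 is 0 and \<open>p 0 = 0\<close> applies.\<close>
  have new_qq: "q (n + 2) \<bullet> q k = 0" if k: "k \<in> {1..n + 1}" for k
  proof -
    have "p (n + 1) \<bullet> p (k - 1) = 0"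
      using pp'[of "n + 1" "k - 1"] k p0 by (cases "k - 1") auto
    then have "p (n + 1) \<bullet> (A *v q k) = (if k = n + 1 then \<beta> k else 0)"
      using r(1)[OF sub[OF k]] k pp'[of "n + 1" k] by (auto simp: inner_add_right)
    then have "(\<gamma> (n + 1) *\<^sub>R q (n + 2)) \<bullet> q k = 0"
      unfolding q_new using qq[of "n + 1" k] k skew_inner[OF skew, of "p (n + 1)" "q k"]
      by (auto simp: inner_diff_left)
    then show ?thesis using r(4)[OF n1] by simp
  qed
  have qq': "q i \<bullet> q k = (if i = k then 1 else 0)" if "i \<in> {1..n + 1 + 1}" "k \<in> {1..n + 1 + 1}" for i k
    using that qq[of i k] new_qq[of i] new_qq[of k] r(6)[OF n1]
    by (cases "i = n + 2"; cases "k = n + 2") (auto simp: inner_commute norm_eq_1)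
  have pq'': "p i \<bullet> q k = 0" if "i \<in> {1..n + 1}" "k \<in> {1..n + 1 + 1}" for i k
    using that pq'[of i k] new_qp[of i] by (cases "k = n + 2") (auto simp: inner_commute)
  show ?case
    unfolding Suc_eq_plus1 by (intro conjI ballI pp' qq' pq'')
qed

section \<open>The Lanczos relations in matrix form\<close>

lemma pos_mem: "pos (k :: 'm::{finite,linorder}) \<in> {1..CARD('m)}"
  using bij_betw_pos by (rule bij_betw_apply) simp

lemma pos_eq_iff: "pos i = pos k \<longleftrightarrow> i = (k :: 'm::{finite,linorder})"
  using bij_betw_pos by (metis bij_betw_def injD)

lemma sum_pos:
  "(\<Sum>k\<in>(UNIV :: 'm::{finite,linorder} set). g (pos k)) = (\<Sum>s\<in>{1..CARD('m)}. g s)"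
  by (rule sum.reindex_bij_betw[OF bij_betw_pos])

lemma columns_matrix_mult:
  fixes x :: "real^'m::{finite,linorder}"
  shows "columns_matrix f *v x = (\<Sum>k\<in>UNIV. x $ k *\<^sub>R f (pos k))"
  by (simp add: vec_eq_iff columns_matrix_def matrix_vector_mult_def mult.commute)

text \<open>The factor \<open>a\<close> covers two uses: 1 for orthonormal columns of one matrix, 0
  for the mutual orthogonality of the columns of \<open>P\<close> and \<open>Q\<close>.\<close>

lemma columns_matrix_inner:
  fixes x y :: "real^'m::{finite,linorder}"
  assumes "\<And>i k. i \<in> {1..CARD('m)} \<Longrightarrow> k \<in> {1..CARD('m)} \<Longrightarrow> f i \<bullet> g k = (if i = k then a else 0)"
  shows "(columns_matrix f *v x) \<bullet> (columns_matrix g *v y) = a * (x \<bullet> y)"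
proof -
  have "(columns_matrix f *v x) \<bullet> (columns_matrix g *v y) =
      (\<Sum>i\<in>UNIV. \<Sum>k\<in>UNIV. x $ i * (y $ k * (if i = k then a else 0)))"
    unfolding columns_matrix_mult inner_sum_left inner_sum_right inner_scaleR_left inner_scaleR_right
      assms[OF pos_mem pos_mem] pos_eq_iff
    by (subst sum.swap) (simp add: sum_distrib_left mult.left_commute)
  also have "\<dots> = a * (x \<bullet> y)"
    by (simp add: inner_vec_def sum_distrib_left if_distrib mult_ac cong: if_cong)
  finally show ?thesis .
qed

lemma sslbd_matrix_Q:
  fixes A :: "real^'n^'n" and x :: "real^'m::{finite,linorder}"
  assumes L: "sslbd A CARD('m) p q \<beta> \<gamma>"
  shows "A *v (columns_matrix q *v x) = columns_matrix p *v (bidiagonal \<beta> \<gamma> *v x)"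
proof -
  have p0: "p 0 = 0" using L by (simp add: sslbd_def)
  have col: "(\<Sum>r\<in>UNIV. bidiagonal \<beta> \<gamma> $ r $ k *\<^sub>R p (pos r)) = A *v q (pos k)" for k :: 'm
  proof -
    have "(\<Sum>r\<in>UNIV. bidiagonal \<beta> \<gamma> $ r $ k *\<^sub>R p (pos r)) =
        (\<Sum>r\<in>(UNIV :: 'm set). (if pos r = pos k then \<beta> (pos r) *\<^sub>R p (pos r) else 0) +
          (if pos r = pos k - 1 then \<gamma> (pos r) *\<^sub>R p (pos r) else 0))"
    proof (intro sum.cong refl)
      fix r :: 'm
      have "pos k = pos r + 1 \<longleftrightarrow> pos r = pos k - 1"
        using pos_mem[of k] pos_mem[of r] by auto
      then show "bidiagonal \<beta> \<gamma> $ r $ k *\<^sub>R p (pos r) =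
          (if pos r = pos k then \<beta> (pos r) *\<^sub>R p (pos r) else 0) +
          (if pos r = pos k - 1 then \<gamma> (pos r) *\<^sub>R p (pos r) else 0)"
        using pos_mem[of k] by (auto simp: bidiagonal_def pos_eq_iff)
    qed
    also have "\<dots> = (\<Sum>s\<in>{1..CARD('m)}. (if s = pos k then \<beta> s *\<^sub>R p s else 0) +
          (if s = pos k - 1 then \<gamma> s *\<^sub>R p s else 0))"
      by (rule sum_pos)
    \<comment> \<open>In the first column \<open>pos k - 1\<close> is 0, outside the summation
      range; the extra term on the right vanishes because \<open>p 0 = 0\<close>.\<close>
    also have "\<dots> = \<beta> (pos k) *\<^sub>R p (pos k) + \<gamma> (pos k - 1) *\<^sub>R p (pos k - 1)"
      using pos_mem[of k] p0 by (auto simp: sum.distrib)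
    finally show ?thesis using sslbd_recurrence(1)[OF L pos_mem[of k]] by simp
  qed
  have "columns_matrix p *v (bidiagonal \<beta> \<gamma> *v x) =
      (\<Sum>r\<in>UNIV. \<Sum>k\<in>UNIV. x $ k *\<^sub>R (bidiagonal \<beta> \<gamma> $ r $ k *\<^sub>R p (pos r)))"
    unfolding columns_matrix_mult
    by (simp add: matrix_vector_mult_def scaleR_sum_left mult.commute)
  also have "\<dots> = (\<Sum>k\<in>UNIV. x $ k *\<^sub>R (A *v q (pos k)))"
    by (subst sum.swap) (simp only: scaleR_sum_right[symmetric] col)
  finally show ?thesis
    by (simp add: columns_matrix_mult linear_sum[OF matrix_vector_mul_linear] linear_scale[OF matrix_vector_mul_linear])
qed

text \<open>The coefficient of \<open>q (CARD('m) + 1)\<close> is left existential: only the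
  direction matters, since the projector onto \<open>U + V\<close> annihilates it.\<close>

lemma sslbd_matrix_P:
  fixes A :: "real^'n^'n" and x :: "real^'m::{finite,linorder}"
  assumes L: "sslbd A CARD('m) p q \<beta> \<gamma>"
  shows "\<exists>a. A *v (columns_matrix p *v x) =
    - (columns_matrix q *v (transpose (bidiagonal \<beta> \<gamma>) *v x)) - a *\<^sub>R q (CARD('m) + 1)"
proof -
  \<comment> \<open>In the last row of the bidiagonal matrix the entry \<gamma> would fall outside
    the matrix; \<open>e\<close> records this missing term.\<close>
  define e where "e = (\<lambda>k::'m. if pos k = CARD('m) then \<gamma> (pos k) else 0)"
  have col: "(\<Sum>r\<in>UNIV. bidiagonal \<beta> \<gamma> $ k $ r *\<^sub>R q (pos r)) =
      - (A *v p (pos k)) - e k *\<^sub>R q (CARD('m) + 1)" for k :: 'm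
  proof -
    have "(\<Sum>r\<in>UNIV. bidiagonal \<beta> \<gamma> $ k $ r *\<^sub>R q (pos r)) =
        (\<Sum>r\<in>(UNIV :: 'm set). (if pos r = pos k then \<beta> (pos k) *\<^sub>R q (pos r) else 0) +
          (if pos r = pos k + 1 then \<gamma> (pos k) *\<^sub>R q (pos r) else 0))"
      by (intro sum.cong refl) (auto simp: bidiagonal_def pos_eq_iff)
    also have "\<dots> = (\<Sum>s\<in>{1..CARD('m)}. (if s = pos k then \<beta> (pos k) *\<^sub>R q s else 0) +
          (if s = pos k + 1 then \<gamma> (pos k) *\<^sub>R q s else 0))"
      by (rule sum_pos)
    also have "\<dots> = \<beta> (pos k) *\<^sub>R q (pos k) + \<gamma> (pos k) *\<^sub>R q (pos k + 1) - e k *\<^sub>R q (CARD('m) + 1)"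
      using pos_mem[of k] by (cases "pos k = CARD('m)") (auto simp: sum.distrib e_def)
    finally show ?thesis using sslbd_recurrence(2)[OF L pos_mem[of k]] by simp
  qed
  have "columns_matrix q *v (transpose (bidiagonal \<beta> \<gamma>) *v x) =
      (\<Sum>r\<in>UNIV. \<Sum>k\<in>UNIV. x $ k *\<^sub>R (bidiagonal \<beta> \<gamma> $ k $ r *\<^sub>R q (pos r)))"
    unfolding columns_matrix_mult
    by (simp add: matrix_vector_mult_def transpose_def scaleR_sum_left mult.commute)
  also have "\<dots> = (\<Sum>k\<in>UNIV. x $ k *\<^sub>R (- (A *v p (pos k)) - e k *\<^sub>R q (CARD('m) + 1)))"
    by (subst sum.swap) (simp only: scaleR_sum_right[symmetric] col)
  also have "\<dots> = - (A *v (columns_matrix p *v x)) - (\<Sum>k\<in>UNIV. x $ k * e k) *\<^sub>R q (CARD('m) + 1)"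
    by (simp add: columns_matrix_mult linear_sum[OF matrix_vector_mul_linear]
        linear_scale[OF matrix_vector_mul_linear] scaleR_diff_right sum_subtractf sum_negf scaleR_sum_left)
  finally show ?thesis by (intro exI[of _ "\<Sum>k\<in>UNIV. x $ k * e k"]) simp
qed

section \<open>Spans of the searching subspaces and the minimal gap\<close>

lemma range_matrix_eq_span:
  fixes P :: "real^'m^'n" and c :: "'m \<Rightarrow> real^'m"
  assumes "orthonormal_family UNIV c"
  shows "range ((*v) P) = span (range (\<lambda>i. P *v c i))"
  using linear_span_image[OF matrix_vector_mul_linear, of P "range c"]
  by (simp add: orthonormal_family_span_UNIV[OF assms] image_image)

lemma span_case_sum: "span (range (case_sum f g)) = span (range f) + span (range g)"
  unfolding UNIV_sum image_Un image_image sum.case span_Un set_plus_def by blast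

lemma sum_UNIV_Plus:
  "(\<Sum>w\<in>(UNIV :: ('a::finite + 'b::finite) set). g w) = (\<Sum>i\<in>UNIV. g (Inl i)) + (\<Sum>i\<in>UNIV. g (Inr i))"
  by (subst UNIV_Plus_UNIV[symmetric], subst sum.Plus) (auto simp: comp_def)

lemma INF_ereal_finite:
  fixes g :: "'i \<Rightarrow> real"
  assumes "finite I" "I \<noteq> {}"
  obtains k where "k \<in> I" "(INF i\<in>I. ereal (g i)) = ereal (g k)" "\<And>i. i \<in> I \<Longrightarrow> g k \<le> g i"
proof -
  obtain k where k: "k \<in> I" "\<And>i. i \<in> I \<Longrightarrow> g k \<le> g i"
    using assms by (metis arg_min_if_finite(1) arg_min_least)
  moreover have "(INF i\<in>I. ereal (g i)) = ereal (g k)"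
    using k by (intro antisym INF_lower INF_greatest) auto
  ultimately show ?thesis using that by blast
qed


section \<open>The angle bound\<close>

theorem theorem4p4:
  fixes A E :: "real^'n^'n"
    and l :: nat
    and \<sigma> :: "nat \<Rightarrow> real"
    and u v :: "nat \<Rightarrow> real^'n"
    and p q :: "nat \<Rightarrow> real^'n"
    and \<beta> \<gamma> :: "nat \<Rightarrow> real"
    and P Q :: "real^'m::{finite,linorder}^'n"
    and B :: "real^'m::{finite,linorder}^'m::{finite,linorder}"
    and \<theta> :: "'m \<Rightarrow> real"
    and c d :: "'m \<Rightarrow> real^'m::{finite,linorder}"
    and ut vt :: "'m \<Rightarrow> real^'n"
    and U V X Z :: "(real^'n) set"
    and j :: nat and j' :: 'm
  assumes "CARD('n) = 2 * l"
    and "invertible A"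
    and "transpose A = - A"
    and "strict_antimono_on {1..l} \<sigma>"
    and "\<forall>k\<in>{1..l}. 0 < \<sigma> k"
    and "{z. eigenvalue (map_matrix complex_of_real A) z} =
      (\<Union>k\<in>{1..l}. {\<i> * complex_of_real (\<sigma> k), - \<i> * complex_of_real (\<sigma> k)})"
    and "\<forall>z. eigenvalue (map_matrix complex_of_real A) z \<longrightarrow>
      simple_eigenvalue (map_matrix complex_of_real A) z"
    and "orthonormal_family ({1..l} <+> {1..l}) (case_sum u v)"
    and "span (u ` {1..l} \<union> v ` {1..l}) = UNIV"
    and "\<forall>k\<in>{1..l}. A *v v k = \<sigma> k *\<^sub>R u k \<and> A *v u k = - \<sigma> k *\<^sub>R v k"
    and "CARD('m) < l"
    and "sslbd A CARD('m) p q \<beta> \<gamma>"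
    and "P = columns_matrix p"
    and "Q = columns_matrix q"
    and "B = bidiagonal \<beta> \<gamma>"
    and "U = range ((*v) P)"
    and "V = range ((*v) Q)"
    and "singular_triplets B \<theta> c d"
    and "\<forall>i. ut i = P *v c i"
    and "\<forall>i. vt i = Q *v d i"
    and "j \<in> {1..l}"
    and "\<forall>i. \<bar>\<sigma> j - \<theta> j'\<bar> \<le> \<bar>\<sigma> j - \<theta> i\<bar>"
    and "X = span {u j, v j}"
    and "Z = span {ut j', vt j'}"
    and "orthogonal_projector E (U + V)"
  shows "sin_angle_F Z X \<le>
    sqrt (1 + real_of_ereal
      (ereal ((onorm ((*v) (E ** A ** (mat 1 - E))))\<^sup>2) /
       (INF i\<in>UNIV - {j'}. ereal (\<bar>\<sigma> j - \<theta> i\<bar>\<^sup>2))))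
    * sin_angle_F (U + V) X"
proof -
  note skew = assms(3) and L = assms(12) and sv = assms(18) and E = assms(25)
  have c: "orthonormal_family UNIV c" and d: "orthonormal_family UNIV d"
    and \<theta>: "\<And>i. 0 \<le> \<theta> i" "\<And>i. B *v d i = \<theta> i *\<^sub>R c i" "\<And>i. transpose B *v c i = \<theta> i *\<^sub>R d i"
      "\<And>i k. i < k \<Longrightarrow> \<theta> k < \<theta> i"
    using sv unfolding singular_triplets_def by blast+
  have \<theta>_inj: "\<theta> i \<noteq> \<theta> k" if "i \<noteq> k" for i k
    using \<theta>(4)[of i k] \<theta>(4)[of k i] that by (cases i k rule: linorder_cases) auto
  have ut: "ut i = columns_matrix p *v c i" and vt: "vt i = columns_matrix q *v d i" for i
    using assms(13,14,19,20) by simp_all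
  note lan = sslbd_orthogonal[OF skew L order_refl]
  have pp: "p i \<bullet> p k = (if i = k then 1 else 0)" and qq: "q i \<bullet> q k = (if i = k then 1 else 0)"
    \<comment> \<open>The redundant conditional matches the premise of
      \<open>columns_matrix_inner\<close> with \<open>a\<close> = 0.\<close>
    and pq: "p i \<bullet> q k = (if i = k then 0 else 0)"
    if "i \<in> {1..CARD('m)}" "k \<in> {1..CARD('m)}" for i k
    using lan that by auto
  have f: "orthonormal_family UNIV (case_sum ut vt)"
  proof -
    have "ut i \<bullet> ut k = (if i = k then 1 else 0)" "vt i \<bullet> vt k = (if i = k then 1 else 0)"
      "ut i \<bullet> vt k = 0" "vt k \<bullet> ut i = 0" for i k
    proof -
      have "ut i \<bullet> ut k = 1 * (c i \<bullet> c k)" "vt i \<bullet> vt k = 1 * (d i \<bullet> d k)"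
        "ut i \<bullet> vt k = 0 * (c i \<bullet> d k)"
        unfolding ut vt by (rule columns_matrix_inner, erule (1) pp qq pq)+
      then show "ut i \<bullet> ut k = (if i = k then 1 else 0)" "vt i \<bullet> vt k = (if i = k then 1 else 0)"
        "ut i \<bullet> vt k = 0" "vt k \<bullet> ut i = 0"
        using c d by (simp_all add: orthonormal_family_def inner_commute)
    qed
    then show ?thesis
      unfolding orthonormal_family_def by (simp add: split_sum_all)
  qed
  have UV: "span (range (case_sum ut vt)) = U + V"
    unfolding span_case_sum
    using assms(16,17,19,20) range_matrix_eq_span[OF c, of P] range_matrix_eq_span[OF d, of Q] by simp
  have inS: "ut i \<in> U + V" "vt i \<in> U + V" for i
    unfolding UV[symmetric]
    by (rule span_base, rule range_eqI[of _ _ "Inl i"], simp)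
      (rule span_base, rule range_eqI[of _ _ "Inr i"], simp)
  have f': "orthonormal_family {Inl j', Inr j'} (case_sum ut vt)"
    using f by (simp add: orthonormal_family_def)
  have Z: "span (case_sum ut vt ` {Inl j', Inr j'}) = Z"
    using assms(24) by simp

  have Avt: "A *v vt i = \<theta> i *\<^sub>R ut i" for i
    using sslbd_matrix_Q[OF L, of "d i"] \<theta>(2)[of i] assms(15)
    by (simp add: ut vt linear_scale[OF matrix_vector_mul_linear])
  \<comment> \<open>The extra q-vector in \<open>sslbd_orthogonal\<close> is orthogonal to both
    searching subspaces.\<close>
  have Eq: "E *v q (CARD('m) + 1) = 0"
  proof (rule orthogonal_projector_eq_0[OF E])
    fix x assume "x \<in> U + V"
    then obtain a b :: "real^'m::{finite,linorder}" where x: "x = columns_matrix p *v a + columns_matrix q *v b"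
      unfolding assms(13,14,16,17) by (blast elim: set_plus_elim)
    have "p (pos k) \<bullet> q (CARD('m) + 1) = 0" "q (pos k) \<bullet> q (CARD('m) + 1) = 0" for k :: 'm
      using lan pos_mem[of k] by auto
    then show "x \<bullet> q (CARD('m) + 1) = 0"
      by (simp add: x columns_matrix_mult inner_add_left inner_sum_left)
  qed
  have EAut: "E *v (A *v ut i) = - \<theta> i *\<^sub>R vt i" for i
  proof -
    obtain a where "A *v ut i = - (\<theta> i *\<^sub>R vt i) - a *\<^sub>R q (CARD('m) + 1)"
      using sslbd_matrix_P[OF L, of "c i"] \<theta>(3)[of i] assms(15)
      by (auto simp: ut vt linear_scale[OF matrix_vector_mul_linear])
    then show ?thesis
      using Eq orthogonal_projector_fixes[OF E inS(2)[of i]]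
      by (simp add: linear_diff[OF matrix_vector_mul_linear] linear_neg[OF matrix_vector_mul_linear]
          linear_scale[OF matrix_vector_mul_linear])
  qed

  have uv: "norm (u j) = 1" "norm (v j) = 1" "u j \<bullet> v j = 0"
  proof -
    have *: "case_sum u v a \<bullet> case_sum u v b = (if a = b then 1 else 0)"
      if "a \<in> {Inl j, Inr j}" "b \<in> {Inl j, Inr j}" for a b
      using assms(8,21) that unfolding orthonormal_family_def by blast
    show "norm (u j) = 1" "norm (v j) = 1" "u j \<bullet> v j = 0"
      using *[of "Inl j" "Inl j"] *[of "Inr j" "Inr j"] *[of "Inl j" "Inr j"]
      by (simp_all add: norm_eq_1)
  qed
  have s: "0 \<le> \<sigma> j" and Av: "A *v v j = \<sigma> j *\<^sub>R u j" and Au: "A *v u j = - \<sigma> j *\<^sub>R v j"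
    using assms(5,10,21) by (auto intro: less_imp_le)

  \<comment> \<open>\<open>t i\<close> is the squared size of the components of \<open>X\<close>
    along the i-th Ritz pair. \<open>R\<close> is the squared sine for \<open>U + V\<close>, and
    \<open>D\<close> is what \<open>Z\<close> misses inside \<open>U + V\<close>, so the goal
    reduces to bounding \<open>D\<close> by a multiple of \<open>R\<close>.\<close>
  define t where "t i = (ut i \<bullet> u j)\<^sup>2 + (vt i \<bullet> u j)\<^sup>2 + (ut i \<bullet> v j)\<^sup>2 + (vt i \<bullet> v j)\<^sup>2" for i
  define R where "R = 2 - (\<Sum>i\<in>UNIV. t i)"
  define D where "D = (\<Sum>i\<in>UNIV - {j'}. t i)"
  define h where "h = onorm ((*v) (E ** A ** (mat 1 - E)))"
  have t_nonneg: "0 \<le> t i" for i by (simp add: t_def)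
  have sinUV: "sin_angle_F (U + V) X = sqrt R"
    unfolding assms(23) sin_angle_F_pair[OF f UV uv] sum_UNIV_Plus
    by (simp add: R_def t_def sum.distrib algebra_simps)
  have "sin_angle_F Z X = sqrt (2 - t j')"
    unfolding assms(23) sin_angle_F_pair[OF f' Z uv] by (simp add: t_def algebra_simps)
  moreover have "(\<Sum>i\<in>UNIV. t i) = t j' + D"
    unfolding D_def by (simp add: sum.remove[of UNIV j'])
  ultimately have sinZ: "sin_angle_F Z X = sqrt (R + D)"
    by (simp add: R_def)

  have Esum: "E *v z = (\<Sum>w\<in>range (case_sum ut vt). (w \<bullet> z) *\<^sub>R w)" for z
    by (rule orthogonal_projector_eq_sum[OF E orthonormal_family_basis[OF f, unfolded UV]])
  have "(norm (z - E *v z))\<^sup>2 = (norm z)\<^sup>2 - (\<Sum>i\<in>UNIV. (ut i \<bullet> z)\<^sup>2 + (vt i \<bullet> z)\<^sup>2)" for z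
    unfolding Esum orthonormal_basis_residual[OF orthonormal_family_basis[OF f]]
    by (simp add: sum.reindex[OF orthonormal_family_inj[OF f]] sum_UNIV_Plus sum.distrib)
  then have res: "R = (norm (u j - E *v u j))\<^sup>2 + (norm (v j - E *v v j))\<^sup>2"
    using uv by (simp add: R_def t_def sum.distrib)

  have "(\<Sum>i\<in>UNIV - {j'}. (\<sigma> j - \<theta> i)\<^sup>2 * t i) \<le> (\<Sum>i\<in>UNIV. (\<sigma> j - \<theta> i)\<^sup>2 * t i)"
    by (intro sum_mono2) (auto simp: t_nonneg)
  also have "\<dots> \<le> (\<Sum>i\<in>UNIV.
      (ut i \<bullet> (A *v (u j - E *v u j)))\<^sup>2 + (vt i \<bullet> (A *v (u j - E *v u j)))\<^sup>2 +
      (ut i \<bullet> (A *v (v j - E *v v j)))\<^sup>2 + (vt i \<bullet> (A *v (v j - E *v v j)))\<^sup>2)"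
    unfolding t_def
    by (intro sum_mono singular_pair_component_bound[OF skew E inS s \<theta>(1) Avt EAut Av Au])
  \<comment> \<open>Ritz vectors lie in \<open>U + V\<close>, so \<open>E\<close> can be inserted
    for free; then Bessel applies to the whole family.\<close>
  also have "\<dots> = (\<Sum>w\<in>UNIV. (case_sum ut vt w \<bullet> (E *v (A *v (u j - E *v u j))))\<^sup>2) +
      (\<Sum>w\<in>UNIV. (case_sum ut vt w \<bullet> (E *v (A *v (v j - E *v v j))))\<^sup>2)"
    by (simp add: sum_UNIV_Plus sum.distrib orthogonal_projector_inner[OF E inS(1)]
        orthogonal_projector_inner[OF E inS(2)])
  also have "\<dots> \<le> (norm (E *v (A *v (u j - E *v u j))))\<^sup>2 + (norm (E *v (A *v (v j - E *v v j))))\<^sup>2"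
    by (intro add_mono orthonormal_family_bessel[OF f])
  also have "\<dots> \<le> (h * norm (u j - E *v u j))\<^sup>2 + (h * norm (v j - E *v v j))\<^sup>2"
    unfolding h_def by (intro add_mono power_mono onorm_compression_bound[OF E] norm_ge_zero)
  also have "\<dots> = h\<^sup>2 * R"
    by (simp add: res power_mult_distrib algebra_simps)
  finally have main: "(\<Sum>i\<in>UNIV - {j'}. (\<sigma> j - \<theta> i)\<^sup>2 * t i) \<le> h\<^sup>2 * R" .

  define K where "K = real_of_ereal (ereal (h\<^sup>2) / (INF i\<in>UNIV - {j'}. ereal (\<bar>\<sigma> j - \<theta> i\<bar>\<^sup>2)))"
  have R: "0 \<le> R" by (simp add: res)
  have "D \<le> K * R"
  proof (cases "UNIV - {j'} = {}")
    \<comment> \<open>With a single Ritz value the infimum is infinite, so the quotient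
      \<open>K\<close> is 0, and \<open>D\<close> is an empty sum.\<close>
    case True
    then show ?thesis unfolding D_def K_def True by (simp add: top_ereal_def)
  next
    case False
    obtain k where k: "k \<in> UNIV - {j'}"
      and inf: "(INF i\<in>UNIV - {j'}. ereal (\<bar>\<sigma> j - \<theta> i\<bar>\<^sup>2)) = ereal (\<bar>\<sigma> j - \<theta> k\<bar>\<^sup>2)"
      and min: "\<And>i. i \<in> UNIV - {j'} \<Longrightarrow> \<bar>\<sigma> j - \<theta> k\<bar>\<^sup>2 \<le> \<bar>\<sigma> j - \<theta> i\<bar>\<^sup>2"
      using INF_ereal_finite[OF _ False, of "\<lambda>i. \<bar>\<sigma> j - \<theta> i\<bar>\<^sup>2"] by auto
    \<comment> \<open>If they were equal, the closest Ritz value \<open>\<theta> j'\<close> would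
      also equal \<open>\<sigma> j\<close>, against the simplicity of the Ritz values. So the
      division is genuine.\<close>
    have "\<sigma> j \<noteq> \<theta> k"
      using assms(22) \<theta>_inj[of j' k] k by (metis DiffE abs_0 abs_le_zero_iff eq_iff_diff_eq_0 insertI1)
    then have pos: "0 < (\<sigma> j - \<theta> k)\<^sup>2" by simp
    have K: "K = h\<^sup>2 / (\<sigma> j - \<theta> k)\<^sup>2"
      unfolding K_def inf using pos by simp
    have "(\<sigma> j - \<theta> k)\<^sup>2 * D \<le> (\<Sum>i\<in>UNIV - {j'}. (\<sigma> j - \<theta> i)\<^sup>2 * t i)"
      unfolding D_def sum_distrib_left using min
      by (intro sum_mono mult_right_mono t_nonneg) simp
    then show ?thesis
      using main pos unfolding K by (simp add: field_simps)
  qed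
  then have "sqrt (R + D) \<le> sqrt ((1 + K) * R)"
    by (simp add: algebra_simps)
  then show ?thesis
    unfolding sinZ sinUV K_def h_def real_sqrt_mult .
qed

end
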